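(* Let $n\ge 2$ be an integer and let $D_n$ be the dihedral group of order $2n$. The girth $gr(Co_{\mathcal{H}}(D_n))$ of the co-maximal hypergraph $Co_{\mathcal{H}}(D_n)$ is either $2$ or $\infty$. In particular, $$gr(Co_{\mathcal{H}}(D_n))=\begin{cases}\infty & \text{if } n=2 \text{ or } n=p^{\alpha}, \text{ where } p \text{ is an odd prime and } \alpha \text{ is a positive integer},\\ 2 & \text{otherwise.}\end{cases}$$
   Context: For $n\ge 1$, $D_n=\langle a,b \mid a^n=e,\ b^2=e,\ bab^{-1}=a^{-1}\rangle$ is the dihedral group of order $2n$ (so $D_2$ is the Klein four-group). For a group $G$, let $S$ be the set of all non-trivial proper subgroups of $G$ (i.e. subgroups different from $\{e\}$ and $G$). For subgroups $H,K$, $HK=\{hk : h\in H, k\in K\}$. The co-maximal hypergraph $Co_{\mathcal{H}}(G)$ has vertex set $V=\{H\in S : HK=G \text{ for some } K\in S\}$, and a subset $E\subseteq V$ is a hyperedge if and only if (1) $HK=G$ for all distinct $H,K\in E$, and (2) no subset $E'\subseteq V$ properly containing $E$ satisfies (1). A path in a hypergraph is an alternating sequence $v_1e_1v_2e_2\ldots v_k$ of distinct vertices and distinct hyperedges such that $v_i,v_{i+1}\in e_i$ for all $1\le i\le k-1$. A cycle is such a sequence in which the first vertex equals the last vertex (all other vertices, and all hyperedges, being distinct) and which has at least two hyperedges. The length of a path or cycle is the number of hyperedges in it. So a cycle of length $2$ is $v_1e_1v_2e_2v_1$ with $v_1\neq v_2$, $e_1\ne e_2$ and $v_1,v_2\in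 e_1\cap e_2$. The girth is the length of a shortest cycle, and is $\infty$ if there is no cycle. *)

theory Defs
  imports "HOL-Algebra.Coset" "HOL-Computational_Algebra.Primes" "HOL-Library.Extended_Nat"
begin

text \<open>A word is a list of letters; the letter \<open>(x, True)\<close> stands for the generator \<open>x\<close> and
  \<open>(x, False)\<close> for its formal inverse. A relator set \<open>R\<close> consists of pairs \<open>(l, r)\<close>, read as the
  relation \<open>l = r\<close>.\<close>

type_synonym 'g word = "('g \<times> bool) list"

inductive pres_eq :: "('g word \<times> 'g word) set \<Rightarrow> 'g word \<Rightarrow> 'g word \<Rightarrow> bool"
  for R :: "('g word \<times> 'g word) set" where
  pres_refl: "pres_eq R u u"
| pres_sym: "pres_eq R u v \<Longrightarrow> pres_eq R v u"
| pres_trans: "pres_eq R u v \<Longrightarrow> pres_eq R v w \<Longrightarrow> pres_eq R u w"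
| pres_append: "pres_eq R u u' \<Longrightarrow> pres_eq R v v' \<Longrightarrow> pres_eq R (u @ v) (u' @ v')"
| pres_cancel: "pres_eq R [(x, s), (x, \<not> s)] []"
| pres_relation: "(l, r) \<in> R \<Longrightarrow> pres_eq R l r"

definition pres_rel :: "('g word \<times> 'g word) set \<Rightarrow> ('g word \<times> 'g word) set" where
  "pres_rel R = {(u, v). pres_eq R u v}"

text \<open>The group with all elements of \<open>'g\<close> as generators and the relations \<open>R\<close>.\<close>

definition presented_group :: "('g word \<times> 'g word) set \<Rightarrow> 'g word set monoid" where
  "presented_group R =
    \<lparr>carrier = UNIV // pres_rel R,
     monoid.mult = (\<lambda>X Y. \<Union>u\<in>X. \<Union>v\<in>Y. pres_rel R `` {u @ v}),
     monoid.one = pres_rel R `` {[]}\<rparr>"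

datatype dihedral_gen = Gen_a | Gen_b

definition dihedral_group :: "nat \<Rightarrow> dihedral_gen word set monoid" where
  "dihedral_group n = presented_group
    {(replicate n (Gen_a, True), []),
     (replicate 2 (Gen_b, True), []),
     ([(Gen_b, True), (Gen_a, True), (Gen_b, False)], [(Gen_a, False)])}"

definition nontrivial_proper_subgroups :: "('a, 'm) monoid_scheme \<Rightarrow> 'a set set" where
  "nontrivial_proper_subgroups G = {H. subgroup H G \<and> H \<noteq> {\<one>\<^bsub>G\<^esub>} \<and> H \<noteq> carrier G}"

definition comaximal_vertices :: "('a, 'm) monoid_scheme \<Rightarrow> 'a set set" where
  "comaximal_vertices G =
    {H \<in> nontrivial_proper_subgroups G.
      \<exists>K \<in> nontrivial_proper_subgroups G. H <#>\<^bsub>G\<^esub> K = carrier G}"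

definition pairwise_comaximal :: "('a, 'm) monoid_scheme \<Rightarrow> 'a set set \<Rightarrow> bool" where
  "pairwise_comaximal G E \<longleftrightarrow> pairwise (\<lambda>H K. H <#>\<^bsub>G\<^esub> K = carrier G) E"

definition comaximal_hyperedges :: "('a, 'm) monoid_scheme \<Rightarrow> 'a set set set" where
  "comaximal_hyperedges G =
    {E. E \<subseteq> comaximal_vertices G \<and> pairwise_comaximal G E \<and>
        \<not> (\<exists>E'. E \<subset> E' \<and> E' \<subseteq> comaximal_vertices G \<and> pairwise_comaximal G E')}"

text \<open>A hypergraph is a pair of its vertex set and its set of hyperedges.\<close>

type_synonym 'v hypergraph = "'v set \<times> 'v set set"

definition comaximal_hypergraph :: "('a, 'm) monoid_scheme \<Rightarrow> 'a set hypergraph" where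
  "comaximal_hypergraph G = (comaximal_vertices G, comaximal_hyperedges G)"

text \<open>The alternating sequence \<open>v\<^sub>1 e\<^sub>1 v\<^sub>2 \<dots> e\<^sub>k v\<^sub>k\<^sub>+\<^sub>1\<close> is split into its vertices \<open>vs\<close>, in which
  \<open>v\<^sub>k\<^sub>+\<^sub>1 = v\<^sub>1\<close> is listed at both ends, and its hyperedges \<open>es\<close>.\<close>

definition hypergraph_cycle :: "'v hypergraph \<Rightarrow> 'v list \<Rightarrow> 'v set list \<Rightarrow> bool" where
  "hypergraph_cycle \<H> vs es \<longleftrightarrow>
    set vs \<subseteq> fst \<H> \<and> set es \<subseteq> snd \<H> \<and>
    length vs = length es + 1 \<and> 2 \<le> length es \<and>
    hd vs = last vs \<and> distinct (butlast vs) \<and> distinct es \<and>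
    (\<forall>i < length es. vs ! i \<in> es ! i \<and> vs ! Suc i \<in> es ! i)"

text \<open>The infimum is attained when a cycle exists, and the infimum of the empty set is \<open>\<infinity>\<close>.\<close>

definition girth :: "'v hypergraph \<Rightarrow> enat" where
  "girth \<H> = Inf {enat (length es) | vs es. hypergraph_cycle \<H> vs es}"

end

theory Submission
  imports Defs
begin

text \<open>Writing the elements of \<open>D\<^sub>n\<close> as \<open>a\<^sup>i b\<^sup>s\<close>, co-maximality is decided by congruences between exponents.
  If \<open>n\<close> is a power of an odd prime, two subgroups can only be co-maximal
  when one of them is \<open>\<langle>a\<rangle>\<close>, so the hypergraph is a star; if \<open>n = 2\<close>, all three vertices form a single
  hyperedge. In all other cases there are vertices \<open>u, v, w, w'\<close> for which \<open>{u, v, w}\<close> and \<open>{u, v, w'}\<close>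
  are pairwise co-maximal but \<open>w, w'\<close> are not co-maximal, so that extending both triples to
  hyperedges yields a cycle of length 2. One takes \<open>u = \<langle>a\<rangle>\<close> and, for even \<open>n > 2\<close>,
  \<open>v = \<langle>a\<^sup>2, b\<rangle>\<close>, \<open>w = \<langle>a\<^sup>2, ab\<rangle>\<close>, \<open>w' = \<langle>ab\<rangle>\<close>; for odd \<open>n = km\<close> with \<open>k\<close> and \<open>m\<close> coprime,
  \<open>v = \<langle>a\<^sup>k, b\<rangle>\<close>, \<open>w = \<langle>a\<^sup>m, b\<rangle>\<close>, \<open>w' = \<langle>a\<^sup>m, ab\<rangle>\<close>.\<close>

section \<open>Girth of a co-maximal hypergraph\<close>

lemma two_le_girth: "2 \<le> girth H"
  unfolding girth_def hypergraph_cycle_def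
  by (intro Inf_greatest) (auto simp: numeral_eq_enat)

lemma girth_infinityI:
  assumes "\<And>vs es. \<not> hypergraph_cycle H vs es"
  shows "girth H = \<infinity>"
proof -
  have "{enat (length es) | vs es. hypergraph_cycle H vs es} = {}"
    using assms by blast
  then show ?thesis unfolding girth_def by (simp add: top_enat_def)
qed

lemma girth_eq_2I:
  assumes "e \<in> snd H" "e' \<in> snd H" "e \<noteq> e'" "{v, w} \<subseteq> e \<inter> e' \<inter> fst H" "v \<noteq> w"
  shows "girth H = 2"
proof (rule antisym)
  have "hypergraph_cycle H [v, w, v] [e, e']"
    using assms unfolding hypergraph_cycle_def by (auto simp: less_Suc_eq)
  then have "enat (length [e, e']) \<in> {enat (length es) | vs es. hypergraph_cycle H vs es}"
    by blast
  then have "girth H \<le> enat (length [e, e'])"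
    unfolding girth_def by (rule Inf_lower)
  then show "girth H \<le> 2" by (simp add: numeral_eq_enat numeral_2_eq_2)
qed (rule two_le_girth)

text \<open>In a cycle each hyperedge is exactly a pair of consecutive vertices, one of them
  \<open>c\<close>. For length 2 the two hyperedges then coincide. For larger length,
  \<open>c\<close> on the first two hyperedges forces it to be their common vertex
  \<open>vs ! 1\<close>, which the third hyperedge misses.\<close>

lemma girth_star:
  assumes "\<And>v w e. e \<in> snd H \<Longrightarrow> v \<in> e \<Longrightarrow> w \<in> e \<Longrightarrow> v \<noteq> w \<Longrightarrow> v = c \<or> w = c"
  shows "girth H = \<infinity>"
proof (rule girth_infinityI, rule notI)
  fix vs es assume cyc: "hypergraph_cycle H vs es"
  define k where "k = length es"
  have len: "length vs = k + 1" "2 \<le> k" and ends: "vs ! 0 = vs ! k"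
    and es: "distinct es" "\<And>i. i < k \<Longrightarrow> es ! i \<in> snd H"
    and inc: "\<And>i. i < k \<Longrightarrow> vs ! i \<in> es ! i \<and> vs ! Suc i \<in> es ! i"
    using cyc unfolding hypergraph_cycle_def k_def
    by (auto simp: hd_conv_nth last_conv_nth simp flip: length_greater_0_conv)
  have dist: "vs ! i \<noteq> vs ! j" if "i < k" "j < k" "i \<noteq> j" for i j
  proof -
    have "distinct (butlast vs)" using cyc by (simp add: hypergraph_cycle_def)
    then show ?thesis using that len by (simp add: distinct_conv_nth nth_butlast)
  qed
  have pair: "es ! i = {vs ! i, vs ! Suc i} \<and> c \<in> es ! i" if "i < k" for i
  proof -
    have "vs ! i \<noteq> vs ! Suc i"
    \<comment> \<open>The closing index \<open>k\<close> lies outside the range of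
      \<open>dist\<close>; there the vertex is \<open>vs ! 0\<close>.\<close>
    proof (cases "Suc i = k")
      case True
      then show ?thesis using dist[of i 0] ends len by auto
    next
      case False
      then show ?thesis using dist[of i "Suc i"] that by auto
    qed
    then show ?thesis using assms[OF es(2)[OF that]] inc[OF that] by blast
  qed
  show False
  proof (cases "k = 2")
    case True
    then have "es ! 0 = es ! 1"
      using pair[of 0] pair[of 1] ends by (auto simp: numeral_2_eq_2)
    then show False using es(1) True k_def by (simp add: nth_eq_iff_index_eq)
  next
    case False
    then have "3 \<le> k" using len by simp
    then have "vs ! 0 \<noteq> vs ! 1" "vs ! 0 \<noteq> vs ! 2" "vs ! 1 \<noteq> vs ! 2"
      using dist by auto
    \<comment> \<open>For \<open>k = 3\<close> the vertex with index 3 is the closing one, equal to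
      \<open>vs ! 0\<close>.\<close>
    moreover have "vs ! 1 \<noteq> vs ! 3"
      using dist[of 1 3] dist[of 1 0] ends \<open>3 \<le> k\<close> by (cases "k = 3") auto
    ultimately show False
      using pair[of 0] pair[of 1] pair[of 2] \<open>3 \<le> k\<close>
      by (auto simp: numeral_2_eq_2 numeral_3_eq_3)
  qed
qed

lemma girth_single_hyperedge:
  assumes "\<And>e e'. e \<in> snd H \<Longrightarrow> e' \<in> snd H \<Longrightarrow> e = e'"
  shows "girth H = \<infinity>"
proof (rule girth_infinityI, rule notI)
  fix vs es assume "hypergraph_cycle H vs es"
  then have es: "set es \<subseteq> snd H" "2 \<le> length es" "distinct es"
    by (auto simp: hypergraph_cycle_def)
  then have len: "0 < length es" "1 < length es" by linarith+
  have "es ! 0 \<noteq> es ! 1"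
    using nth_eq_iff_index_eq[OF es(3) len] by simp
  then show False using assms nth_mem[OF len(1)] nth_mem[OF len(2)] es(1) by blast
qed

section \<open>Co-maximality in a general group\<close>

lemma comaximal_verticesI:
  assumes "H \<in> nontrivial_proper_subgroups G" "K \<in> nontrivial_proper_subgroups G"
    and "H <#>\<^bsub>G\<^esub> K = carrier G"
  shows "H \<in> comaximal_vertices G"
  using assms by (auto simp: comaximal_vertices_def)

text \<open>Inversion maps HK onto KH and the group onto itself.\<close>

lemma (in group) set_mult_eq_carrier_commute:
  assumes "subgroup H G" "subgroup K G" "H <#> K = carrier G"
  shows "K <#> H = carrier G"
proof
  show "K <#> H \<subseteq> carrier G"
    using assms by (simp add: set_mult_closed subgroup.subset)
  show "carrier G \<subseteq> K <#> H"
  proof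
    fix g assume g: "g \<in> carrier G"
    then have "inv g \<in> H <#> K" using assms by simp
    then obtain h k where hk: "h \<in> H" "k \<in> K" "inv g = h \<otimes> k"
      by (auto simp: set_mult_def)
    then have c: "h \<in> carrier G" "k \<in> carrier G"
      using assms subgroup.mem_carrier by metis+
    then have "g = inv k \<otimes> inv h"
      using hk(3) g by (metis inv_inv inv_mult_group)
    moreover have "inv k \<in> K" "inv h \<in> H"
      using hk assms by (simp_all add: subgroup.m_inv_closed)
    ultimately show "g \<in> K <#> H" by (auto simp: set_mult_def)
  qed
qed

text \<open>There are only finitely many sets of vertices, so a maximal pairwise co-maximal one
  exists above \<open>E\<close>.\<close>

lemma comaximal_hyperedge_extends:
  assumes "finite (carrier G)" "E \<subseteq> comaximal_vertices G" "pairwise_comaximal G E"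
  obtains E' where "E' \<in> comaximal_hyperedges G" "E \<subseteq> E'"
proof -
  let ?C = "{E. E \<subseteq> comaximal_vertices G \<and> pairwise_comaximal G E}"
  have "comaximal_vertices G \<subseteq> Pow (carrier G)"
    by (auto simp: comaximal_vertices_def nontrivial_proper_subgroups_def
        dest: subgroup.subset)
  then have "finite (comaximal_vertices G)"
    using assms(1) by (meson finite_Pow_iff finite_subset)
  then have "finite ?C"
    by (rule finite_subset[rotated, OF finite_Pow_iff[THEN iffD2]]) auto
  from finite_has_maximal2[OF this, of E] assms
  obtain E' where "E' \<in> ?C" "E \<subseteq> E'" "\<forall>F\<in>?C. E' \<subseteq> F \<longrightarrow> E' = F" by auto
  then have "E' \<in> comaximal_hyperedges G"
    unfolding comaximal_hyperedges_def by blast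
  then show thesis using \<open>E \<subseteq> E'\<close> that by blast
qed

lemma (in group) comaximal_girth_eq_2I:
  assumes fin: "finite (carrier G)"
    and sub: "{u, v, w, w'} \<subseteq> nontrivial_proper_subgroups G"
    and co: "u <#> v = carrier G" "u <#> w = carrier G" "u <#> w' = carrier G"
      "v <#> w = carrier G" "v <#> w' = carrier G"
    and nco: "w <#> w' \<noteq> carrier G"
    and ne: "u \<noteq> v" "w \<noteq> w'"
  shows "girth (comaximal_hypergraph G) = 2"
proof -
  have sg: "subgroup u G" "subgroup v G" "subgroup w G" "subgroup w' G"
    using sub by (auto simp: nontrivial_proper_subgroups_def)
  have co': "v <#> u = carrier G" "w <#> u = carrier G" "w' <#> u = carrier G"
      "w <#> v = carrier G" "w' <#> v = carrier G"
    using co sg by (simp_all add: set_mult_eq_carrier_commute)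
  have vert: "{u, v, w, w'} \<subseteq> comaximal_vertices G"
    using sub co co' comaximal_verticesI by (metis empty_subsetI insert_subset)
  have "pairwise_comaximal G {u, v, w}" "pairwise_comaximal G {u, v, w'}"
    using co co' by (auto simp: pairwise_comaximal_def pairwise_def)
  then obtain e e' where e: "e \<in> comaximal_hyperedges G" "{u, v, w} \<subseteq> e"
    and e': "e' \<in> comaximal_hyperedges G" "{u, v, w'} \<subseteq> e'"
    using vert comaximal_hyperedge_extends[OF fin] by (metis insert_subset)
  \<comment> \<open>A common extension would contain the pair \<open>w\<close>, \<open>w'\<close>,
    which is not co-maximal.\<close>
  have "e \<noteq> e'"
  proof
    assume "e = e'"
    then have "w \<in> e" "w' \<in> e" "pairwise_comaximal G e"
      using e e' by (auto simp: comaximal_hyperedges_def)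
    then show False using nco ne by (auto simp: pairwise_comaximal_def pairwise_def)
  qed
  then show ?thesis
    using e e' vert ne by (intro girth_eq_2I[of e _ e' u v]) (auto simp: comaximal_hypergraph_def)
qed

section \<open>Subgroups of dihedral groups\<close>

text \<open>Here \<open>elt i s\<close> stands for \<open>a\<^sup>i b\<^sup>s\<close>.\<close>

locale dihedral =
  fixes G (structure) and n :: nat and elt :: "int \<Rightarrow> bool \<Rightarrow> 'a"
  assumes n_ge_2: "2 \<le> n"
    and carrier_eq: "carrier G = {elt i s | i s. True}"
    and elt_eq_iff: "elt i s = elt j t \<longleftrightarrow> s = t \<and> int n dvd i - j"
    and mult_elt: "elt i s \<otimes> elt j t = elt (if s then i - j else i + j) (s \<noteq> t)"
    and one_eq: "\<one> = elt 0 False"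
begin

lemma elt_in_carrier [simp]: "elt i s \<in> carrier G"
  by (auto simp: carrier_eq)

lemma elt_cases:
  assumes "x \<in> carrier G"
  obtains i s where "x = elt i s"
  using assms by (auto simp: carrier_eq)

sublocale group G
proof (rule groupI)
  fix x assume "x \<in> carrier G"
  then obtain i s where "x = elt i s" by (rule elt_cases)
  then have "elt (if s then i else - i) s \<otimes> x = \<one>"
    by (simp add: mult_elt one_eq)
  then show "\<exists>y\<in>carrier G. y \<otimes> x = \<one>"
    using elt_in_carrier by blast
qed (auto elim!: elt_cases simp: mult_elt one_eq algebra_simps)

lemma inv_elt: "inv (elt i s) = elt (if s then i else - i) s"
  by (rule inv_equality) (auto simp: mult_elt one_eq)

lemma finite_carrier: "finite (carrier G)"
proof -
  have "elt i s \<in> case_prod elt ` ({0..<int n} \<times> UNIV)" for i s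
  proof -
    have "elt i s = elt (i mod int n) s" by (simp add: elt_eq_iff mod_eq_dvd_iff[symmetric])
    moreover have "i mod int n \<in> {0..<int n}" using n_ge_2 by simp
    ultimately show ?thesis by force
  qed
  then have "carrier G \<subseteq> case_prod elt ` ({0..<int n} \<times> UNIV)"
    by (auto simp: carrier_eq)
  then show ?thesis by (rule finite_subset) auto
qed

lemma set_mult_eq_carrierI:
  assumes "H \<subseteq> carrier G" "K \<subseteq> carrier G"
    and "\<And>i s. \<exists>h\<in>H. \<exists>k\<in>K. elt i s = h \<otimes> k"
  shows "H <#> K = carrier G"
proof
  show "H <#> K \<subseteq> carrier G" using assms by (simp add: set_mult_closed)
  show "carrier G \<subseteq> H <#> K" using assms(3) by (auto simp: carrier_eq set_mult_def)
qed

definition rotations :: "'a set" where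
  "rotations = {elt i False | i. True}"

lemma elt_in_rotations: "elt i s \<in> rotations \<longleftrightarrow> \<not> s"
  by (auto simp: rotations_def elt_eq_iff intro: exI[of _ i])

lemma rotations_subset: "rotations \<subseteq> carrier G"
  by (auto simp: rotations_def)

lemma rotations_nontrivial_proper: "rotations \<in> nontrivial_proper_subgroups G"
proof -
  have "subgroup rotations G"
    by (rule subgroupI) (auto simp: rotations_def mult_elt inv_elt)
  moreover have "elt 1 False \<noteq> \<one>"
    using n_ge_2 by (simp add: one_eq elt_eq_iff)
  moreover have "elt 1 False \<in> rotations" "elt 0 True \<notin> rotations"
    by (auto simp: elt_in_rotations)
  ultimately show ?thesis
    unfolding nontrivial_proper_subgroups_def using elt_in_carrier by blast
qed

text \<open>The subgroup generated by \<open>a\<^sup>d\<close> and \<open>a\<^sup>r b\<close>, provided that \<open>d\<close> divides \<open>n\<close>.\<close>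

definition dih :: "int \<Rightarrow> int \<Rightarrow> 'a set" where
  "dih d r = {elt i s | i s. d dvd (if s then i - r else i)}"

lemma dihI: "d dvd (if s then i - r else i) \<Longrightarrow> elt i s \<in> dih d r"
  unfolding dih_def by blast

lemma dihE:
  assumes "x \<in> dih d r"
  obtains i s where "x = elt i s" "d dvd (if s then i - r else i)"
  using assms unfolding dih_def by blast

lemma dih_subset: "dih d r \<subseteq> carrier G"
  by (auto simp: dih_def)

text \<open>An exponent is determined only modulo n, so reading membership off a given
  representative requires d to divide n.\<close>

lemma elt_in_dih:
  assumes "d dvd int n"
  shows "elt i s \<in> dih d r \<longleftrightarrow> d dvd (if s then i - r else i)"
proof
  assume "elt i s \<in> dih d r"
  then obtain j where j: "int n dvd i - j" "d dvd (if s then j - r else j)"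
    by (auto simp: dih_def elt_eq_iff)
  have "d dvd i - j" using assms j(1) dvd_trans by blast
  from dvd_add[OF this j(2)] show "d dvd (if s then i - r else i)"
    by (simp split: if_splits)
qed (rule dihI)

lemma dih_nontrivial_proper:
  assumes "d dvd int n" "1 < d"
  shows "dih d r \<in> nontrivial_proper_subgroups G"
proof -
  have "subgroup (dih d r) G"
  proof (rule subgroupI)
    show "dih d r \<noteq> {}" using elt_in_dih[OF assms(1), of 0 False] by auto
    show "inv x \<in> dih d r" if "x \<in> dih d r" for x
      using that by (elim dihE) (auto simp: inv_elt intro: dihI split: if_splits)
    fix x y assume "x \<in> dih d r" "y \<in> dih d r"
    then obtain i s j t where xy: "x = elt i s" "y = elt j t"
      and d: "d dvd (if s then i - r else i)" "d dvd (if t then j - r else j)"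
      by (metis dihE)
    show "x \<otimes> y \<in> dih d r"
      using dvd_add[OF d] dvd_diff[OF d]
      by (cases s; cases t) (auto simp: xy mult_elt elt_in_dih[OF assms(1)] algebra_simps)
  qed (rule dih_subset)
  \<comment> \<open>The reflection a^r b witnesses non-triviality, even for d = n; the rotation a,
    excluded by d > 1, witnesses properness.\<close>
  moreover have "elt r True \<in> dih d r" "elt 1 False \<notin> dih d r"
    using assms by (auto simp: elt_in_dih)
  moreover have "elt r True \<noteq> \<one>"
    by (simp add: one_eq elt_eq_iff)
  ultimately show ?thesis
    unfolding nontrivial_proper_subgroups_def using elt_in_carrier by blast
qed

text \<open>The elements e and a^r b of \<open>dih d r\<close> represent both cosets of the
  rotations.\<close>

lemma rotations_mult_dih:
  assumes "d dvd int n"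
  shows "rotations <#> dih d r = carrier G"
proof (rule set_mult_eq_carrierI[OF rotations_subset dih_subset])
  fix i s
  have "elt i s = elt (if s then i - r else i) False \<otimes> elt (if s then r else 0) s"
    by (simp add: mult_elt)
  moreover have "elt (if s then r else 0) s \<in> dih d r"
    by (simp add: elt_in_dih[OF assms])
  ultimately show "\<exists>h\<in>rotations. \<exists>k\<in>dih d r. elt i s = h \<otimes> k"
    by (metis elt_in_rotations)
qed

text \<open>Bezout splits the exponent into a multiple of d, taken as a rotation in the first
  factor, and a multiple of e, which together with a possible reflection a^r b goes into the
  second.\<close>

lemma dih_mult_dih_coprime:
  assumes "d dvd int n" "e dvd int n" "coprime d e"
  shows "dih d q <#> dih e r = carrier G"
proof (rule set_mult_eq_carrierI[OF dih_subset dih_subset])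
  fix i s
  define j where "j = (if s then i - r else i)"
  obtain x y where "x * d + y * e = 1"
    using assms(3) bezout_int[of d e] by (auto simp: coprime_iff_gcd_eq_1)
  then have "j * x * d + j * y * e = j"
    by (metis distrib_left mult.assoc mult.right_neutral)
  then have "j * x * d + (j * y * e + (if s then r else 0)) = i"
    by (simp add: j_def flip: add.assoc)
  then have "elt i s = elt (j * x * d) False \<otimes> elt (j * y * e + (if s then r else 0)) s"
    by (simp add: mult_elt)
  moreover have "elt (j * x * d) False \<in> dih d q"
    and "elt (j * y * e + (if s then r else 0)) s \<in> dih e r"
    by (simp_all add: elt_in_dih assms)
  ultimately show "\<exists>h\<in>dih d q. \<exists>k\<in>dih e r. elt i s = h \<otimes> k" by blast
qed

text \<open>For even n, \<open>dih 2 0\<close> has index 2 and consists of the elements with even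
  exponent; ab, which lies in \<open>dih d 1\<close>, represents the other coset.\<close>

lemma dih_2_mult_dih_even:
  assumes "2 dvd d" "d dvd int n"
  shows "dih 2 0 <#> dih d 1 = carrier G"
proof (rule set_mult_eq_carrierI[OF dih_subset dih_subset])
  fix i s
  have "2 dvd int n" using assms dvd_trans by blast
  note mem = elt_in_dih[OF this] elt_in_dih[OF assms(2)]
  show "\<exists>h\<in>dih 2 0. \<exists>k\<in>dih d 1. elt i s = h \<otimes> k"
  proof (cases "even i")
    case True
    have "elt i s = elt i s \<otimes> elt 0 False" by (simp add: mult_elt)
    moreover have "elt i s \<in> dih 2 0" "elt 0 False \<in> dih d 1" using True by (auto simp: mem)
    ultimately show ?thesis by blast
  next
    case False
    have "elt i s = elt (if s then i - 1 else i + 1) (\<not> s) \<otimes> elt 1 True"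
      by (simp add: mult_elt)
    moreover have "elt (if s then i - 1 else i + 1) (\<not> s) \<in> dih 2 0" "elt 1 True \<in> dih d 1"
      using False by (auto simp: mem)
    ultimately show ?thesis by blast
  qed
qed

text \<open>The rotation a is missing from the product: modulo m, a product of two rotations has
  exponent 0 and a product of two reflections has exponent q - r, and neither is congruent to
  1.\<close>

lemma dih_mult_dih_not_carrier:
  assumes "d dvd int n" "e dvd int n" "m dvd d" "m dvd e" "1 < m" "\<not> m dvd q - r - 1"
  shows "dih d q <#> dih e r \<noteq> carrier G"
proof
  assume "dih d q <#> dih e r = carrier G"
  then have "elt 1 False \<in> dih d q <#> dih e r" by simp
  then obtain h k where "h \<in> dih d q" "k \<in> dih e r" "elt 1 False = h \<otimes> k"
    unfolding set_mult_def by blast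
  then obtain i s j t where hk: "d dvd (if s then i - q else i)" "e dvd (if t then j - r else j)"
    and "elt 1 False = elt i s \<otimes> elt j t"
    by (metis dihE)
  then have st: "s = t" and n: "int n dvd 1 - (if s then i - j else i + j)"
    by (auto simp: mult_elt elt_eq_iff)
  have m: "m dvd 1 - (if s then i - j else i + j)" "m dvd (if s then i - q else i)"
    "m dvd (if s then j - r else j)"
    using n hk assms dvd_trans st by blast+
  show False
  proof (cases s)
    case True
    with m have "m dvd - ((1 - (i - j)) + (i - q) - (j - r))"
      by (simp only: if_True dvd_minus_iff dvd_add dvd_diff)
    then show False using assms(6) by (simp add: algebra_simps)
  next
    case False
    with m have "m dvd (1 - (i + j)) + i + j"
      by (simp only: if_False dvd_add)
    then show False using assms(5) by simp
  qed
qed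

lemma dih_neq_rotations: "rotations \<noteq> dih d r"
proof -
  have "elt r True \<in> dih d r" "elt r True \<notin> rotations"
    by (simp_all add: dihI elt_in_rotations)
  then show ?thesis by metis
qed

section \<open>The cases of girth 2\<close>

lemma girth_even:
  assumes "even n" "n \<noteq> 2"
  shows "girth (comaximal_hypergraph G) = 2"
proof -
  have n: "2 dvd int n" "int n dvd int n" "2 < int n" using assms n_ge_2 by auto
  show ?thesis
  proof (rule comaximal_girth_eq_2I[OF finite_carrier])
    show "{rotations, dih 2 0, dih 2 1, dih (int n) 1} \<subseteq> nontrivial_proper_subgroups G"
      using n rotations_nontrivial_proper dih_nontrivial_proper by simp
    \<comment> \<open>The rotation a^2 lies in \<open>dih 2 1\<close> but not in
      \<open>dih (int n) 1\<close>, which is the subgroup generated by ab; here n > 2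
      enters.\<close>
    have "\<not> int n dvd 2" using n by (auto dest: zdvd_imp_le)
    then show "dih 2 1 \<noteq> dih (int n) 1"
      using elt_in_dih[OF n(1), of 2 False 1] elt_in_dih[OF n(2), of 2 False 1] by auto
    show "dih 2 1 <#> dih (int n) 1 \<noteq> carrier G"
      using n by (intro dih_mult_dih_not_carrier[where m = 2]) auto
  qed (use n rotations_mult_dih dih_2_mult_dih_even dih_neq_rotations in auto)
qed

lemma girth_odd_coprime_factors:
  assumes "odd n" "n = k * m" "coprime k m" "1 < k" "1 < m"
  shows "girth (comaximal_hypergraph G) = 2"
proof -
  have km: "int k dvd int n" "int m dvd int n" "coprime (int k) (int m)"
    "1 < int k" "1 < int m" using assms by auto
  \<comment> \<open>With q = 0 and r = 1 the criterion for a product to miss a asks that m not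
    divide -2, which oddness of n provides.\<close>
  have "m \<noteq> 2" using assms by auto
  then have m: "\<not> int m dvd 2" "\<not> int m dvd 1" using km by (auto dest: zdvd_imp_le)
  show ?thesis
  proof (rule comaximal_girth_eq_2I[OF finite_carrier])
    show "{rotations, dih k 0, dih m 0, dih m 1} \<subseteq> nontrivial_proper_subgroups G"
      using km rotations_nontrivial_proper dih_nontrivial_proper by simp
    show "dih m 0 \<noteq> dih m 1"
      using elt_in_dih[OF km(2), of 1 True 0] elt_in_dih[OF km(2), of 1 True 1] m by auto
    show "dih m 0 <#> dih m 1 \<noteq> carrier G"
      using km m by (intro dih_mult_dih_not_carrier[where m = m]) auto
  qed (use km rotations_mult_dih dih_mult_dih_coprime dih_neq_rotations in auto)
qed

section \<open>Powers of an odd prime\<close>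

lemma subgroup_elt_diff:
  assumes "subgroup H G" "elt i s \<in> H" "elt j s \<in> H"
  shows "elt (i - j) False \<in> H"
proof -
  have "elt i s \<otimes> inv (elt j s) \<in> H"
    using assms by (simp add: subgroup.m_closed subgroup.m_inv_closed)
  then show ?thesis by (cases s) (simp_all add: inv_elt mult_elt)
qed

lemma subgroup_elt_mult:
  assumes "subgroup H G" "elt i False \<in> H"
  shows "elt (k * i) False \<in> H"
proof (induction k rule: int_induct[where k = 0])
  case base
  then show ?case using subgroup.one_closed[OF assms(1)] by (simp add: one_eq)
next
  case (step1 k)
  from subgroup.m_closed[OF assms(1) this(2) assms(2)] show ?case
    by (simp add: mult_elt algebra_simps)
next
  case (step2 k)
  from subgroup_elt_diff[OF assms(1) this(2) assms(2)] show ?case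
    by (simp add: algebra_simps)
qed

text \<open>An exponent invertible modulo n makes a^i a generator of the rotations.\<close>

lemma subgroup_elt_coprime:
  assumes "subgroup H G" "elt i False \<in> H" "coprime i (int n)"
  shows "elt j False \<in> H"
proof -
  obtain x y where "x * i + y * int n = 1"
    using assms(3) bezout_int[of i "int n"] by (auto simp: coprime_iff_gcd_eq_1)
  then have "x * i - 1 = - y * int n" by simp
  moreover have "j * x * i - j = j * (x * i - 1)" by (simp add: algebra_simps)
  ultimately have "int n dvd j * x * i - j" by simp
  then have "elt (j * x * i) False = elt j False"
    by (simp add: elt_eq_iff)
  then show ?thesis using subgroup_elt_mult[OF assms(1,2), of "j * x"] by simp
qed

text \<open>The rotations together with any single reflection generate the whole group.\<close>

lemma proper_subgroup_eq_rotations: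
  assumes "H \<in> nontrivial_proper_subgroups G" "\<And>i. elt i False \<in> H"
  shows "H = rotations"
proof
  have sg: "subgroup H G" "H \<noteq> carrier G"
    using assms(1) by (auto simp: nontrivial_proper_subgroups_def)
  show "rotations \<subseteq> H" using assms(2) by (auto simp: rotations_def)
  have "elt j True \<notin> H" for j
  proof
    assume "elt j True \<in> H"
    then have "elt (i - j) False \<otimes> elt j True \<in> H" for i
      using assms(2) subgroup.m_closed[OF sg(1)] by blast
    then have "elt i s \<in> H" for i s
      using assms(2) by (cases s) (auto simp: mult_elt)
    then have "carrier G \<subseteq> H" by (auto elim: elt_cases)
    then show False using sg subgroup.subset by blast
  qed
  then show "H \<subseteq> rotations"
    using subgroup.subset[OF sg(1)]
    by (auto simp: carrier_eq rotations_def subset_iff) (metis (full_types))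
qed

text \<open>Otherwise i - j is coprime to n, so the rotation a^(i-j) in \<open>H\<close> generates
  all rotations, and \<open>H\<close>, being proper, equals \<open>rotations\<close>.\<close>

lemma proper_subgroup_prime_power_dvd:
  assumes "n = p ^ \<alpha>" "prime p" "H \<in> nontrivial_proper_subgroups G" "H \<noteq> rotations"
    and "elt i s \<in> H" "elt j s \<in> H"
  shows "int p dvd i - j"
proof (rule ccontr)
  assume "\<not> int p dvd i - j"
  moreover have "prime (int p)" using assms(2) by simp
  ultimately have "coprime (i - j) (int n)"
    using assms(1) by (simp add: prime_imp_coprime coprime_commute)
  moreover have "subgroup H G" using assms(3) by (simp add: nontrivial_proper_subgroups_def)
  ultimately show False
    using subgroup_elt_diff assms(3-6) subgroup_elt_coprime proper_subgroup_eq_rotations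
    by metis
qed

text \<open>Modulo \<open>p\<close>, the exponents of the rotations in \<open>H\<close> and \<open>K\<close> vanish and those of the
  reflections are constant, so \<open>H <#> K\<close> meets at most two of the \<open>p\<close> classes of rotations.\<close>

lemma comaximal_odd_prime_power:
  assumes n: "n = p ^ \<alpha>" "prime p" "odd p"
    and H: "H \<in> nontrivial_proper_subgroups G" and K: "K \<in> nontrivial_proper_subgroups G"
    and HK: "H <#> K = carrier G"
  shows "H = rotations \<or> K = rotations"
proof (rule ccontr)
  assume "\<not> (H = rotations \<or> K = rotations)"
  then have "H \<noteq> rotations" "K \<noteq> rotations" by auto
  note dvdH = proper_subgroup_prime_power_dvd[OF n(1,2) H this(1)]
    and dvdK = proper_subgroup_prime_power_dvd[OF n(1,2) K this(2)]
  have sg: "subgroup H G" "subgroup K G"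
    using H K by (auto simp: nontrivial_proper_subgroups_def)
  have "\<alpha> \<noteq> 0" using n n_ge_2 by (cases \<alpha>) auto
  then have pn: "int p dvd int n" using n by simp
  \<comment> \<open>Oddness of p is what makes 0, 1 and 2 distinct modulo p.\<close>
  have "3 \<le> p" using n prime_ge_2_nat[of p] by (cases "p = 2") auto
  then have p: "\<not> int p dvd 1" "\<not> int p dvd 2" by (auto dest: zdvd_imp_le)
  have one: "elt 0 False \<in> H" "elt 0 False \<in> K"
    using sg subgroup.one_closed one_eq by metis+
  \<comment> \<open>A factorization of a^c into two rotations is ruled out: comparison with the
    identity, of exponent 0, shows that p divides both exponents.\<close>
  have refl: "\<exists>i j. elt i True \<in> H \<and> elt j True \<in> K \<and> int p dvd c - (i - j)"
    if c: "\<not> int p dvd c" for c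
  proof -
    have "elt c False \<in> H <#> K" using HK by simp
    then obtain h k where hk: "h \<in> H" "k \<in> K" "elt c False = h \<otimes> k"
      by (auto simp: set_mult_def)
    then obtain i s j t where e: "h = elt i s" "k = elt j t"
      using sg subgroup.mem_carrier elt_cases by metis
    then have st: "t = s" "int n dvd c - (if s then i - j else i + j)"
      using hk(3) by (auto simp: mult_elt elt_eq_iff)
    then have d: "int p dvd c - (if s then i - j else i + j)" using pn dvd_trans by blast
    show ?thesis
    proof (cases s)
      case True
      then show ?thesis using d e st hk by auto
    next
      case False
      then have "int p dvd (c - (i + j)) + (i - 0) + (j - 0)"
        using d dvdH[of i False 0] dvdK[of j False 0] hk e st one by (intro dvd_add) auto
      then show ?thesis using c by simp
    qed
  qed
  obtain i j where 1: "elt i True \<in> H" "elt j True \<in> K" "int p dvd 1 - (i - j)"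
    using refl p by blast
  obtain i' j' where 2: "elt i' True \<in> H" "elt j' True \<in> K" "int p dvd 2 - (i' - j')"
    using refl p by blast
  \<comment> \<open>The reflections of \<open>H\<close> share one exponent modulo p, and so do those
    of \<open>K\<close>; hence i - j and i' - j' agree modulo p, although they are congruent to 1
    and 2.\<close>
  have "int p dvd i' - i" "int p dvd j' - j"
    using 1 2 dvdH dvdK by blast+
  with 1 2 have "int p dvd ((2 - (i' - j')) - (1 - (i - j))) + ((i' - i) - (j' - j))"
    by (simp only: dvd_add dvd_diff)
  then show False using p by simp
qed

lemma girth_odd_prime_power:
  assumes "n = p ^ \<alpha>" "prime p" "odd p"
  shows "girth (comaximal_hypergraph G) = \<infinity>"
proof (rule girth_star)
  fix v w e
  assume e: "e \<in> snd (comaximal_hypergraph G)" "v \<in> e" "w \<in> e" "v \<noteq> w"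
  then have "v <#> w = carrier G" "e \<subseteq> nontrivial_proper_subgroups G"
    by (auto simp: comaximal_hypergraph_def comaximal_hyperedges_def comaximal_vertices_def
        pairwise_comaximal_def pairwise_def)
  with e show "v = rotations \<or> w = rotations"
    using comaximal_odd_prime_power[OF assms] by blast
qed

section \<open>The Klein four-group\<close>

lemma klein_four_comaximal:
  assumes n: "n = 2" and H: "H \<in> nontrivial_proper_subgroups G"
    and K: "K \<in> nontrivial_proper_subgroups G" and "H \<noteq> K"
  shows "H <#> K = carrier G"
proof -
  let ?x = "elt 1 False" and ?y = "elt 0 True" and ?z = "elt 1 True"
  have "elt i s \<in> {\<one>, ?x, ?y, ?z}" for i s
    by (cases s; cases "even i") (auto simp: one_eq elt_eq_iff n)
  then have car: "carrier G = {\<one>, ?x, ?y, ?z}"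
    by (auto simp: carrier_eq one_eq)
  have mult: "?x \<otimes> ?y = ?z" "?y \<otimes> ?x = ?z" "?x \<otimes> ?z = ?y" "?z \<otimes> ?x = ?y"
    "?y \<otimes> ?z = ?x" "?z \<otimes> ?y = ?x"
    by (simp_all add: mult_elt elt_eq_iff n)
  \<comment> \<open>Any two of the three involutions multiply to the third, so a proper subgroup
    contains at most one of them.\<close>
  have two: "L \<in> {{\<one>, ?x}, {\<one>, ?y}, {\<one>, ?z}}" if "L \<in> nontrivial_proper_subgroups G" for L
  proof -
    have L: "subgroup L G" "L \<noteq> {\<one>}" "L \<noteq> carrier G"
      using that by (auto simp: nontrivial_proper_subgroups_def)
    have sub: "L \<subseteq> {\<one>, ?x, ?y, ?z}" and one: "\<one> \<in> L"
      using subgroup.subset[OF L(1)] car subgroup.one_closed[OF L(1)] by auto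
    have cl: "?x \<in> L \<Longrightarrow> ?y \<in> L \<Longrightarrow> ?z \<in> L" "?x \<in> L \<Longrightarrow> ?z \<in> L \<Longrightarrow> ?y \<in> L"
      "?y \<in> L \<Longrightarrow> ?z \<in> L \<Longrightarrow> ?x \<in> L"
      using subgroup.m_closed[OF L(1)] mult by metis+
    have "\<not> {?x, ?y, ?z} \<subseteq> L"
      using one sub L(3) unfolding car by (metis insert_subset subset_antisym)
    then have "\<not> (?x \<in> L \<and> ?y \<in> L \<and> ?z \<in> L)" by simp
    with cl have "\<not> (?x \<in> L \<and> ?y \<in> L)" "\<not> (?x \<in> L \<and> ?z \<in> L)" "\<not> (?y \<in> L \<and> ?z \<in> L)"
      by blast+
    then show ?thesis using sub one L(2) by blast
  qed
  \<comment> \<open>For distinct involutions u and v the four listed products exhaust the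
    group.\<close>
  have set_mult: "{\<one>, u} <#> {\<one>, v} = {\<one>, u, v, u \<otimes> v}"
    if "u \<in> carrier G" "v \<in> carrier G" for u v
    using that by (auto simp: set_mult_def)
  show ?thesis
    using two[OF H] two[OF K] \<open>H \<noteq> K\<close> by (auto simp: set_mult car mult)
qed

text \<open>All vertices together are pairwise co-maximal, so by maximality the only hyperedge is
  the full vertex set.\<close>

lemma girth_klein_four:
  assumes "n = 2"
  shows "girth (comaximal_hypergraph G) = \<infinity>"
proof (rule girth_single_hyperedge)
  have "pairwise_comaximal G (comaximal_vertices G)"
    using klein_four_comaximal[OF assms]
    by (auto simp: pairwise_comaximal_def pairwise_def comaximal_vertices_def)
  then have "e = comaximal_vertices G" if "e \<in> snd (comaximal_hypergraph G)" for e
    using that by (auto simp: comaximal_hypergraph_def comaximal_hyperedges_def)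
  then show "e = e'"
    if "e \<in> snd (comaximal_hypergraph G)" "e' \<in> snd (comaximal_hypergraph G)" for e e'
    using that by blast
qed

section \<open>The case distinction on n\<close>

lemma girth_eq:
  "girth (comaximal_hypergraph G) =
    (if n = 2 \<or> (\<exists>(p::nat) (\<alpha>::nat). prime p \<and> odd p \<and> \<alpha> > 0 \<and> n = p ^ \<alpha>) then \<infinity> else 2)"
proof (cases "n = 2 \<or> (\<exists>(p::nat) (\<alpha>::nat). prime p \<and> odd p \<and> \<alpha> > 0 \<and> n = p ^ \<alpha>)")
  case True
  then show ?thesis using girth_klein_four girth_odd_prime_power by auto
next
  case False
  have "girth (comaximal_hypergraph G) = 2"
  proof (cases "even n")
    case True
    then show ?thesis using girth_even False by blast
  next
    case odd: False
    obtain p where p: "prime p" "p dvd n"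
      using prime_factor_nat[of n] n_ge_2 by auto
    \<comment> \<open>Splitting off the full p-part gives coprime factors; the cofactor m is not 1
      because n is not a power of an odd prime.\<close>
    obtain m where m: "n = p ^ multiplicity p n * m" "\<not> p dvd m"
      using multiplicity_decompose'[of n p] p n_ge_2 by (metis not_prime_unit not_numeral_le_zero)
    have k: "0 < multiplicity p n"
      using p n_ge_2 by (simp add: prime_multiplicity_gt_zero_iff)
    have "odd p" using p odd by (meson dvd_trans)
    then have "m \<noteq> 1" using False m p k by (metis mult.right_neutral)
    moreover have "m \<noteq> 0" using m(2) by (metis dvd_0_right)
    moreover have "1 < p ^ multiplicity p n"
      by (rule one_less_power[OF prime_gt_1_nat[OF p(1)] k])
    ultimately show ?thesis
      using girth_odd_coprime_factors[OF odd m(1)] p(1) m(2) by (simp add: prime_imp_coprime)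
  qed
  then show ?thesis using False by simp
qed

end

section \<open>The presentation\<close>

lemmas [trans] = pres_trans

lemma pres_eq_context: "pres_eq R u v \<Longrightarrow> pres_eq R (x @ u @ y) (x @ v @ y)"
  by (intro pres_append pres_refl)

lemma equiv_pres_rel: "equiv UNIV (pres_rel R)"
  by (rule equivI)
    (auto simp: pres_rel_def refl_on_def sym_def trans_def intro: pres_refl pres_sym pres_trans)

lemma pres_rel_class_eq_iff: "pres_rel R `` {u} = pres_rel R `` {v} \<longleftrightarrow> pres_eq R u v"
  using eq_equiv_class_iff[OF equiv_pres_rel, of u v R] by (simp add: pres_rel_def)

text \<open>Since \<open>pres_eq\<close> is a congruence, every choice of representatives
  contributes the same class, and the union over the non-empty classes collapses to it.\<close>

lemma presented_group_mult_class:
  "pres_rel R `` {u} \<otimes>\<^bsub>presented_group R\<^esub> pres_rel R `` {v} = pres_rel R `` {u @ v}"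
proof -
  let ?U = "pres_rel R `` {u}" and ?V = "pres_rel R `` {v}"
  have "pres_rel R `` {u' @ v'} = pres_rel R `` {u @ v}"
    if "u' \<in> ?U" "v' \<in> ?V" for u' v'
    using that unfolding pres_rel_class_eq_iff
    by (auto simp: pres_rel_def intro: pres_append pres_sym)
  then have "(\<Union>u'\<in>?U. \<Union>v'\<in>?V. pres_rel R `` {u' @ v'}) = (\<Union>u'\<in>?U. \<Union>v'\<in>?V. pres_rel R `` {u @ v})"
    by (intro SUP_cong refl)
  moreover have "u \<in> ?U" "v \<in> ?V"
    by (simp_all add: pres_rel_def pres_refl)
  then have "?U \<noteq> {}" "?V \<noteq> {}" by auto
  ultimately show ?thesis by (simp add: presented_group_def)
qed

definition dihedral_relators :: "nat \<Rightarrow> (dihedral_gen word \<times> dihedral_gen word) set" where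
  "dihedral_relators n =
    {(replicate n (Gen_a, True), []),
     (replicate 2 (Gen_b, True), []),
     ([(Gen_b, True), (Gen_a, True), (Gen_b, False)], [(Gen_a, False)])}"

abbreviation dihedral_eq ("_ \<approx>[_] _" [51, 0, 51] 50) where
  "u \<approx>[n] v \<equiv> pres_eq (dihedral_relators n) u v"

text \<open>The pair \<open>(i, s)\<close> encodes \<open>a\<^sup>i b\<^sup>s\<close> in the infinite dihedral group.\<close>

fun word_val :: "dihedral_gen word \<Rightarrow> int \<times> bool" where
  "word_val [] = (0, False)"
| "word_val ((Gen_a, e) # w) = (fst (word_val w) + (if e then 1 else - 1), snd (word_val w))"
| "word_val ((Gen_b, e) # w) = (- fst (word_val w), \<not> snd (word_val w))"

lemma word_val_append:
  "word_val (u @ v) =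
    (if snd (word_val u) then fst (word_val u) - fst (word_val v)
     else fst (word_val u) + fst (word_val v), snd (word_val u) \<noteq> snd (word_val v))"
  by (induction u rule: word_val.induct) auto

lemma word_val_replicate_a:
  "word_val (replicate k (Gen_a, e)) = (if e then int k else - int k, False)"
  by (induction k) auto

text \<open>Soundness: every rule, relators included, preserves the reflection bit and the exponent
  modulo n. This keeps the presented group from collapsing below 2n elements.\<close>

lemma dihedral_eq_word_val:
  assumes "u \<approx>[n] v"
  shows "snd (word_val u) = snd (word_val v) \<and> int n dvd fst (word_val u) - fst (word_val v)"
  using assms
proof induction
  case (pres_sym u v)
  then show ?case by (simp add: dvd_diff_commute)
next
  case (pres_trans u v w)
  then have "int n dvd fst (word_val u) - fst (word_val v)"
    "int n dvd fst (word_val v) - fst (word_val w)" by auto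
  from dvd_add[OF this] show ?case using pres_trans.IH by simp
next
  case (pres_append u u' v v')
  then have "int n dvd fst (word_val u) - fst (word_val u')"
    "int n dvd fst (word_val v) - fst (word_val v')" by auto
  from dvd_add[OF this] dvd_diff[OF this] show ?case
    using pres_append.IH by (auto simp: word_val_append algebra_simps)
next
  case (pres_cancel x s)
  then show ?case by (cases x) auto
next
  case (pres_relation l r)
  then show ?case
    by (auto simp: dihedral_relators_def word_val_replicate_a numeral_2_eq_2)
qed simp

section \<open>Reduction of words to normal form\<close>

definition a_power :: "int \<Rightarrow> dihedral_gen word" where
  "a_power i = replicate (nat \<bar>i\<bar>) (Gen_a, 0 \<le> i)"

definition normal_word :: "int \<Rightarrow> bool \<Rightarrow> dihedral_gen word" where
  "normal_word i s = a_power i @ (if s then [(Gen_b, True)] else [])"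

lemma word_val_normal_word: "word_val (normal_word i s) = (i, s)"
  by (auto simp: normal_word_def a_power_def word_val_append word_val_replicate_a)

text \<open>A letter of the same sign as i literally lengthens the power; one of opposite sign
  cancels its first letter.\<close>

lemma a_power_Cons: "(Gen_a, e) # a_power i \<approx>[n] a_power (i + (if e then 1 else - 1))"
proof (cases "if e then 0 \<le> i else i \<le> 0")
  case True
  then have "nat \<bar>i + (if e then 1 else - 1)\<bar> = Suc (nat \<bar>i\<bar>)"
    by (auto split: if_splits)
  with True have "(Gen_a, e) # a_power i = a_power (i + (if e then 1 else - 1))"
    by (cases "i = 0") (auto simp: a_power_def split: if_splits)
  then show ?thesis by (simp add: pres_refl)
next
  case False
  then have "nat \<bar>i\<bar> = Suc (nat \<bar>i + (if e then 1 else - 1)\<bar>)"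
    by (auto split: if_splits)
  with False have "a_power i = (Gen_a, \<not> e) # a_power (i + (if e then 1 else - 1))"
    by (cases "i + (if e then 1 else - 1) = 0") (auto simp: a_power_def split: if_splits)
  then show ?thesis
    using pres_eq_context[OF pres_cancel[of _ Gen_a e], where x = "[]"] by simp
qed

lemma a_power_add: "a_power i @ a_power j \<approx>[n] a_power (i + j)"
proof -
  have "replicate k (Gen_a, e) @ a_power j \<approx>[n] a_power (j + (if e then int k else - int k))" for k e
  proof (induction k)
    case (Suc k)
    have "replicate (Suc k) (Gen_a, e) @ a_power j
        \<approx>[n] (Gen_a, e) # a_power (j + (if e then int k else - int k))"
      using pres_eq_context[OF Suc, where x = "[(Gen_a, e)]" and y = "[]"] by simp
    also have "\<dots> \<approx>[n] a_power (j + (if e then int k else - int k) + (if e then 1 else - 1))"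
      by (rule a_power_Cons)
    finally show ?case by (cases e) (simp_all add: algebra_simps)
  qed (simp add: pres_refl)
  from this[of "nat \<bar>i\<bar>" "0 \<le> i"] show ?thesis
    by (cases "0 \<le> i") (simp_all add: a_power_def add.commute)
qed

lemma gen_b_square: "[(Gen_b, True), (Gen_b, True)] \<approx>[n] []"
  by (rule pres_relation) (simp add: dihedral_relators_def numeral_2_eq_2)

lemma gen_b_inverse: "[(Gen_b, e)] \<approx>[n] [(Gen_b, True)]"
proof (cases e)
  case False
  have "[(Gen_b, False)] \<approx>[n] [(Gen_b, False), (Gen_b, True), (Gen_b, True)]"
    using pres_eq_context[OF pres_sym[OF gen_b_square], where x = "[(Gen_b, False)]" and y = "[]"] by simp
  also have "\<dots> \<approx>[n] [(Gen_b, True)]"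
    using pres_eq_context[OF pres_cancel[of _ Gen_b False], where x = "[]" and y = "[(Gen_b, True)]"] by simp
  finally show ?thesis using False by simp
qed (simp add: pres_refl)

text \<open>For the letter a this is the conjugation relator multiplied by b on the right. For its
  inverse, insert a a^-1 in front and apply the first case backwards.\<close>

lemma gen_b_gen_a: "[(Gen_b, True), (Gen_a, e)] \<approx>[n] [(Gen_a, \<not> e), (Gen_b, True)]"
proof -
  let ?b = "(Gen_b, True)" and ?a = "(Gen_a, True)" and ?c = "(Gen_a, False)"
  have "[?b, ?a] \<approx>[n] [?b, ?a, (Gen_b, False), ?b]"
    using pres_eq_context[OF pres_sym[OF pres_cancel[of _ Gen_b False]], where x = "[?b, ?a]" and y = "[]"] by simp
  also have "\<dots> \<approx>[n] [?c, ?b]"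
    using pres_eq_context[OF pres_relation[of "[?b, ?a, (Gen_b, False)]" "[?c]"], where x = "[]" and y = "[?b]"]
    by (simp add: dihedral_relators_def)
  finally have *: "[?b, ?a] \<approx>[n] [?c, ?b]" .
  have "[?b, ?c] \<approx>[n] [?a, ?c, ?b, ?c]"
    using pres_eq_context[OF pres_sym[OF pres_cancel[of _ Gen_a True]], where x = "[]" and y = "[?b, ?c]"] by simp
  also have "\<dots> \<approx>[n] [?a, ?b, ?a, ?c]"
    using pres_eq_context[OF pres_sym[OF *], where x = "[?a]" and y = "[?c]"] by simp
  also have "\<dots> \<approx>[n] [?a, ?b]"
    using pres_eq_context[OF pres_cancel[of _ Gen_a True], where x = "[?a, ?b]" and y = "[]"] by simp
  finally show ?thesis using * by (cases e) simp_all
qed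

lemma gen_b_a_power: "(Gen_b, e) # a_power i \<approx>[n] a_power (- i) @ [(Gen_b, True)]"
proof -
  have *: "(Gen_b, True) # replicate k (Gen_a, s) \<approx>[n] replicate k (Gen_a, \<not> s) @ [(Gen_b, True)]"
    for k s
  proof (induction k)
    case (Suc k)
    have "(Gen_b, True) # replicate (Suc k) (Gen_a, s)
        \<approx>[n] (Gen_a, \<not> s) # (Gen_b, True) # replicate k (Gen_a, s)"
      using pres_eq_context[OF gen_b_gen_a, where x = "[]" and y = "replicate k (Gen_a, s)"] by simp
    also have "\<dots> \<approx>[n] replicate (Suc k) (Gen_a, \<not> s) @ [(Gen_b, True)]"
      using pres_eq_context[OF Suc, where x = "[(Gen_a, \<not> s)]" and y = "[]"] by simp
    finally show ?case .
  qed (simp add: pres_refl)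
  have "(Gen_b, e) # a_power i \<approx>[n] (Gen_b, True) # a_power i"
    using pres_eq_context[OF gen_b_inverse, where x = "[]" and y = "a_power i"] by simp
  also have "\<dots> \<approx>[n] a_power (- i) @ [(Gen_b, True)]"
  \<comment> \<open>At i = 0 the sign flags of \<open>a_power i\<close> and
    \<open>a_power (- i)\<close> are both True instead of opposite, but both words are
    empty.\<close>
  proof (cases "i = 0")
    case False
    then have "0 \<le> - i \<longleftrightarrow> \<not> 0 \<le> i" by linarith
    then show ?thesis using *[of "nat \<bar>i\<bar>" "0 \<le> i"] by (simp only: a_power_def abs_minus_cancel)
  qed (simp add: a_power_def pres_refl)
  finally show ?thesis .
qed

text \<open>Completeness: each new front letter is absorbed into the power of a, or moved through it
  as b, where it meets \<open>t\<close> and cancels if \<open>t\<close> already holds a b.\<close>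

lemma dihedral_eq_normal_word: "w \<approx>[n] case_prod normal_word (word_val w)"
proof (induction w)
  case Nil
  then show ?case by (simp add: normal_word_def a_power_def pres_refl)
next
  case (Cons x w)
  obtain g e where x: "x = (g, e)" by (cases x)
  obtain i s where w: "word_val w = (i, s)" by (cases "word_val w")
  define t :: "dihedral_gen word" where "t = (if s then [(Gen_b, True)] else [])"
  have "x # w \<approx>[n] ((g, e) # a_power i) @ t"
    using pres_eq_context[OF Cons, where x = "[x]" and y = "[]"]
    by (simp add: x w normal_word_def t_def)
  also have "\<dots> \<approx>[n] case_prod normal_word (word_val (x # w))"
  proof (cases g)
    case Gen_a
    then show ?thesis
      using pres_eq_context[OF a_power_Cons, where x = "[]" and y = t]
      by (simp add: x w normal_word_def t_def)
  next
    case Gen_b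
    then have "((g, e) # a_power i) @ t \<approx>[n] a_power (- i) @ (Gen_b, True) # t"
      using pres_eq_context[OF gen_b_a_power, where x = "[]" and y = t] by simp
    also have "\<dots> \<approx>[n] normal_word (- i) (\<not> s)"
      using pres_eq_context[OF gen_b_square, where x = "a_power (- i)" and y = "[]"]
      by (simp add: normal_word_def t_def pres_refl)
    finally show ?thesis by (simp add: Gen_b x w)
  qed
  finally show ?case .
qed

lemma a_power_multiple_order: "a_power (int n * int k) \<approx>[n] []"
proof (induction k)
  case (Suc k)
  have "a_power (int n * int (Suc k)) \<approx>[n] a_power (int n) @ a_power (int n * int k)"
    using pres_sym[OF a_power_add[where i = "int n" and j = "int n * int k"]] by (simp add: algebra_simps)
  also have "\<dots> \<approx>[n] [] @ []"
    by (intro pres_append Suc pres_relation) (simp add: a_power_def dihedral_relators_def)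
  finally show ?case by simp
qed (simp add: a_power_def pres_refl)

lemma normal_word_cong:
  assumes "int n dvd i - j"
  shows "normal_word i s \<approx>[n] normal_word j s"
proof -
  have *: "a_power (j + int n * int k) \<approx>[n] a_power j" for j k
  proof -
    have "a_power (j + int n * int k) \<approx>[n] a_power j @ a_power (int n * int k)"
      by (rule pres_sym[OF a_power_add])
    also have "\<dots> \<approx>[n] a_power j"
      using pres_eq_context[OF a_power_multiple_order, where x = "a_power j" and y = "[]"] by simp
    finally show ?thesis .
  qed
  obtain c where c: "i - j = int n * c" using assms by (auto elim: dvdE)
  have "a_power i \<approx>[n] a_power j"
  proof (cases "0 \<le> c")
    case True
    then show ?thesis using *[of j "nat c"] c by (simp add: algebra_simps)
  next
    case False
    \<comment> \<open>For negative \<open>c\<close> the multiple of n is added to i instead of j,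
      since \<open>*\<close> covers only non-negative multiples.\<close>
    then have "i + int n * int (nat (- c)) = j" using c by simp
    then show ?thesis using *[of i "nat (- c)"] by (simp add: pres_sym)
  qed
  from pres_eq_context[OF this, where x = "[]"] show ?thesis by (simp add: normal_word_def)
qed

text \<open>This solves the word problem: words with congruent values reduce to normal words that
  the relation a^n = e identifies.\<close>

lemma dihedral_eq_iff_word_val:
  "u \<approx>[n] v \<longleftrightarrow> snd (word_val u) = snd (word_val v) \<and> int n dvd fst (word_val u) - fst (word_val v)"
proof
  assume "snd (word_val u) = snd (word_val v) \<and> int n dvd fst (word_val u) - fst (word_val v)"
  then have "case_prod normal_word (word_val u) \<approx>[n] case_prod normal_word (word_val v)"
    by (simp add: split_beta normal_word_cong)
  then show "u \<approx>[n] v"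
    by (meson dihedral_eq_normal_word pres_sym pres_trans)
qed (rule dihedral_eq_word_val)

text \<open>The bridge from the presentation to the locale: classes of normal words play the role of
  a^i b^s, and the solved word problem gives the equality and multiplication rules.\<close>

lemma dihedral_dihedral_group:
  assumes "2 \<le> n"
  shows "dihedral (dihedral_group n) n (\<lambda>i s. pres_rel (dihedral_relators n) `` {normal_word i s})"
proof -
  let ?R = "dihedral_relators n"
  have G: "dihedral_group n = presented_group ?R"
    by (simp add: dihedral_group_def dihedral_relators_def)
  show ?thesis
  proof
    have "pres_rel ?R `` {w} = pres_rel ?R `` {case_prod normal_word (word_val w)}" for w
      by (simp only: pres_rel_class_eq_iff dihedral_eq_normal_word)
    then show "carrier (dihedral_group n) = {pres_rel ?R `` {normal_word i s} | i s. True}"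
      by (fastforce simp: G presented_group_def quotient_def split_beta)
    show "\<one>\<^bsub>dihedral_group n\<^esub> = pres_rel ?R `` {normal_word 0 False}"
      by (simp add: G presented_group_def normal_word_def a_power_def)
  qed (use assms in \<open>auto simp: G presented_group_mult_class pres_rel_class_eq_iff
      dihedral_eq_iff_word_val word_val_append word_val_normal_word\<close>)
qed

theorem theorem2p6:
  fixes n :: nat
  assumes "n \<ge> 2"
  shows "girth (comaximal_hypergraph (dihedral_group n)) \<in> {2, \<infinity>} \<and>
    girth (comaximal_hypergraph (dihedral_group n)) =
      (if n = 2 \<or> (\<exists>(p::nat) (\<alpha>::nat). prime p \<and> odd p \<and> \<alpha> > 0 \<and> n = p ^ \<alpha>) then \<infinity> else 2)"
  using dihedral.girth_eq[OF dihedral_dihedral_group[OF assms]] by simp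

end
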